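(* Let $M\in\mathbb{R}^{2n\times 2n}$ be a (symmetric) positive definite matrix with Williamson decomposition $M=S^{-T}\tilde D S^{-1}$. Let $E\in\mathbb{R}^{2n\times 2n}$ be any symmetric matrix with $\|E\|=1$. For $\varepsilon>0$ such that $M_\varepsilon:=M+\varepsilon E$ is positive definite, let $M_\varepsilon=S_\varepsilon^{-T}\tilde D_\varepsilon S_\varepsilon^{-1}$ be its Williamson decomposition. Then for any $\varepsilon$ such that $M_\varepsilon$ is positive definite and $$0<\varepsilon<\min\left\{\frac{\|M\|}{(6\kappa(M))^{4/3}},\ \frac{1}{2\|M\|},\ \|M\|\right\},$$ one has $$\|S^{-T}S^{-1}-S_\varepsilon^{-T}S_\varepsilon^{-1}\|\le 9\pi n^3\,\kappa(M)^2\,\|M^{-1}\|^{1/4}\,\varepsilon^{1/4}.$$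
   Context: Let $\sigma=\begin{pmatrix}0&\mathbb{1}_n\\-\mathbb{1}_n&0\end{pmatrix}\in\mathbb{R}^{2n\times 2n}$ be the standard symplectic form and $Sp(2n)$ the group of real $2n\times 2n$ symplectic matrices ($S^T\sigma S=\sigma$). Williamson's theorem: for every symmetric positive definite $M\in\mathbb{R}^{2n\times 2n}$ there exist $S\in Sp(2n)$ and a diagonal matrix $D\in\mathbb{R}^{n\times n}$ with $D_{11}\ge\dots\ge D_{nn}>0$ such that $S^TMS=\tilde D:=\operatorname{diag}(D,D)$; equivalently $M=S^{-T}\tilde DS^{-1}$, which is called a Williamson decomposition of $M$ (here $S^{-T}=(S^{-1})^T$). $\|\cdot\|$ denotes the operator norm (largest singular value), and $\kappa(A)=\|A\|\,\|A^{-1}\|$ is the condition number. *)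

theory Defs
  imports "HOL-Analysis.Analysis"
begin

text \<open>
  The type \<open>'n\<close> plays the role of \<open>{1, \<dots>, n}\<close>, so \<open>n = CARD('n)\<close>; its linear order is used
  only to say that the diagonal entries of \<open>D\<close> are listed in decreasing order.
  Matrices of size \<open>2n \<times> 2n\<close> are indexed by \<open>'n + 'n\<close>, with \<open>Inl\<close> for the first \<open>n\<close>
  coordinates and \<open>Inr\<close> for the last \<open>n\<close>.
\<close>

definition block_matrix ::
  "real^'n^'n \<Rightarrow> real^'n^'n \<Rightarrow> real^'n^'n \<Rightarrow> real^'n^'n \<Rightarrow> real^('n + 'n)^('n + 'n)" where
  "block_matrix A B C D = (\<chi> i j.
     case i of
       Inl a \<Rightarrow> (case j of Inl b \<Rightarrow> A $ a $ b | Inr b \<Rightarrow> B $ a $ b)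
     | Inr a \<Rightarrow> (case j of Inl b \<Rightarrow> C $ a $ b | Inr b \<Rightarrow> D $ a $ b))"

definition symplectic_form :: "real^('n::finite + 'n)^('n + 'n)" where
  "symplectic_form = block_matrix 0 (mat 1) (- mat 1) 0"

definition symplectic :: "real^('n::finite + 'n)^('n + 'n) \<Rightarrow> bool" where
  "symplectic S \<longleftrightarrow> transpose S ** symplectic_form ** S = symplectic_form"

definition symmetric_matrix :: "real^'m^'m \<Rightarrow> bool" where
  "symmetric_matrix A \<longleftrightarrow> transpose A = A"

definition positive_definite :: "real^'m^'m \<Rightarrow> bool" where
  "positive_definite A \<longleftrightarrow> symmetric_matrix A \<and> (\<forall>x. x \<noteq> 0 \<longrightarrow> x \<bullet> (A *v x) > 0)"

text \<open>The operator norm with respect to the Euclidean norm. (The library's \<open>norm\<close> on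
  matrices is the Frobenius norm.)\<close>

definition op_norm :: "real^'m^'m \<Rightarrow> real" where
  "op_norm A = onorm (\<lambda>x. A *v x)"

definition cond_num :: "real^'m^'m \<Rightarrow> real" where
  "cond_num A = op_norm A * op_norm (matrix_inv A)"

definition williamson_diagonal :: "real^('n::{finite,linorder})^('n::{finite,linorder}) \<Rightarrow> bool" where
  "williamson_diagonal D \<longleftrightarrow>
     (\<forall>i j. i \<noteq> j \<longrightarrow> D $ i $ j = 0) \<and>
     (\<forall>i j. i \<le> j \<longrightarrow> D $ j $ j \<le> D $ i $ i) \<and>
     (\<forall>i. D $ i $ i > 0)"

definition williamson_decomposition ::
  "real^('n::{finite,linorder} + 'n)^('n + 'n) \<Rightarrow> real^('n + 'n)^('n + 'n) \<Rightarrow> real^('n::{finite,linorder})^('n::{finite,linorder}) \<Rightarrow> bool" where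
  "williamson_decomposition M S D \<longleftrightarrow>
     symplectic S \<and> williamson_diagonal D \<and>
     M = transpose (matrix_inv S) ** block_matrix D 0 0 D ** matrix_inv S"

end

theory Submission
  imports Defs
begin

text \<open>
  Put \<open>P = S\<^sup>-\<^sup>T S\<^sup>-\<^sup>1\<close> and let \<open>J\<close> be the symplectic form. Then \<open>P (J M J\<^sup>T) P = M\<close>, i.e. \<open>P\<close> is the
  geometric mean of \<open>M\<close> and \<open>J\<^sup>T M\<^sup>-\<^sup>1 J\<close>. Geometric means are monotone and homogeneous: if
  \<open>M' \<le> a M\<close> and \<open>M \<le> b M'\<close> in the Loewner order, then \<open>P' \<le> \<surd>(a b) P\<close>, which is seen by evaluating
  both equations at a generalised eigenvector \<open>P' x = \<lambda> P x\<close> for the largest \<open>\<lambda>\<close>.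
  With \<open>\<delta> = \<epsilon> \<parallel>M\<^sup>-\<^sup>1\<parallel>\<close> we have \<open>(1 - \<delta>) M \<le> M\<^sub>\<epsilon> \<le> (1 + \<delta>) M\<close>, so \<open>P\<close> and \<open>P\<^sub>\<epsilon>\<close> agree up
  to the factor \<open>\<surd>((1 + \<delta>) / (1 - \<delta>)) \<le> 1 + 2 \<delta>\<close>, while comparison with the identity matrix gives
  \<open>\<parallel>P\<parallel> \<le> \<surd>\<kappa>(M)\<close>. The resulting bound \<open>2 \<delta> \<surd>\<kappa>(M)\<close> is linear in \<open>\<epsilon>\<close>, hence stronger than needed.
\<close>

section \<open>Quadratic forms\<close>

lemma inner_symmetric_matrix:
  fixes A :: "real^'m^'m"
  assumes "symmetric_matrix A"
  shows "x \<bullet> (A *v y) = (A *v x) \<bullet> y"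
  by (metis assms dot_lmul_matrix symmetric_matrix_def transpose_matrix_vector)

text \<open>Moving from \<open>x\<close> by \<open>- t Zx\<close> changes the form at first order by
  \<open>- 2 t |Zx|^2\<close>. A form that is nonnegative everywhere and zero at \<open>x\<close>
  allows no such decrease for small t > 0.\<close>

lemma psd_null_vector:
  fixes Z :: "real^'m^'m"
  assumes sym: "symmetric_matrix Z"
    and nonneg: "\<And>y. 0 \<le> y \<bullet> (Z *v y)"
    and null: "x \<bullet> (Z *v x) = 0"
  shows "Z *v x = 0"
proof -
  define v where "v = Z *v x"
  define q where "q = v \<bullet> (Z *v v)"
  have expand: "0 \<le> - 2 * t * (v \<bullet> v) + t\<^sup>2 * q" for t
  proof -
    have "0 \<le> (x - t *\<^sub>R v) \<bullet> (Z *v (x - t *\<^sub>R v))"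
      by (rule nonneg)
    also have "\<dots> = x \<bullet> (Z *v x) - t * (x \<bullet> (Z *v v)) - t * (v \<bullet> (Z *v x)) + t\<^sup>2 * q"
      by (simp add: algebra_simps q_def power2_eq_square inner_diff_left inner_diff_right
          matrix_vector_mult_diff_distrib matrix_vector_mult_scaleR)
    also have "\<dots> = - 2 * t * (v \<bullet> v) + t\<^sup>2 * q"
      using null inner_symmetric_matrix[OF sym, of x v] by (simp add: v_def)
    finally show ?thesis .
  qed
  have "q \<ge> 0" using nonneg q_def by simp
  \<comment> \<open>The quadratic in \<open>expand\<close> is minimal at
    \<open>(v \<bullet> v) / q\<close>; the added 1 keeps the denominator positive when
    \<open>q = 0\<close> and still gives \<open>t * q \<le> v \<bullet> v\<close>.\<close>
  define t where "t = (v \<bullet> v) / (q + 1)"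
  have "t * q \<le> v \<bullet> v"
    using \<open>q \<ge> 0\<close> by (simp add: t_def field_simps)
  moreover have "t \<ge> 0" using \<open>q \<ge> 0\<close> by (simp add: t_def)
  ultimately have "t\<^sup>2 * q \<le> t * (v \<bullet> v)"
    by (metis mult.assoc mult_left_mono power2_eq_square)
  with expand[of t] have "t * (v \<bullet> v) \<le> 0" by simp
  then have "(v \<bullet> v)\<^sup>2 \<le> 0"
    using \<open>q \<ge> 0\<close> by (simp add: t_def power2_eq_square divide_le_0_iff)
  then show ?thesis by (simp add: v_def)
qed

text \<open>A maximiser of the Rayleigh quotient works: with \<open>l\<close> the maximum,
  \<open>l Y - X\<close> is positive semidefinite and its form vanishes at \<open>x\<close>, so
  \<open>psd_null_vector\<close> yields the eigenvector equation.\<close>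

lemma generalized_eigenvector:
  fixes X Y :: "real^'m^'m"
  assumes X: "symmetric_matrix X" and Y: "positive_definite Y"
  obtains x l where "x \<noteq> 0" "X *v x = l *\<^sub>R (Y *v x)" "\<And>y. y \<bullet> (X *v y) \<le> l * (y \<bullet> (Y *v y))"
proof -
  have posY: "0 < y \<bullet> (Y *v y)" if "y \<noteq> 0" for y
    using Y that by (simp add: positive_definite_def)
  define f where "f y = (y \<bullet> (X *v y)) / (y \<bullet> (Y *v y))" for y
  have "continuous_on (sphere 0 1) f"
    unfolding f_def
    by (intro continuous_intros linear_continuous_on matrix_vector_mul_bounded_linear)
      (metis mem_sphere_0 norm_zero posY less_irrefl zero_neq_one)
  moreover have "sphere (0 :: real^'m) 1 \<noteq> {}"
    by simp
  ultimately obtain x where x: "x \<in> sphere 0 1" and max: "\<And>y. y \<in> sphere 0 1 \<Longrightarrow> f y \<le> f x"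
    using continuous_attains_sup[OF compact_sphere] by metis
  from x have x0: "x \<noteq> 0" by auto
  \<comment> \<open>The quotient \<open>f\<close> is invariant under scaling, so its maximum on the
    unit sphere bounds it at every nonzero vector.\<close>
  have le: "y \<bullet> (X *v y) \<le> f x * (y \<bullet> (Y *v y))" for y
  proof (cases "y = 0")
    case False
    define u where "u = (1 / norm y) *\<^sub>R y"
    have "u \<in> sphere 0 1" using False by (simp add: u_def)
    then have "f u \<le> f x" by (rule max)
    moreover have "f u = f y"
      using False by (simp add: f_def u_def matrix_vector_mult_scaleR)
    ultimately show ?thesis
      using posY[OF False] by (simp add: f_def[of y] pos_divide_le_eq)
  qed simp
  define Z where "Z = f x *\<^sub>R Y - X"
  have Zv: "Z *v y = f x *\<^sub>R (Y *v y) - X *v y" for y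
    by (simp add: Z_def matrix_vector_mult_diff_rdistrib flip: scaleR_matrix_vector_assoc)
  have "symmetric_matrix Z"
    using X Y by (simp add: Z_def symmetric_matrix_def positive_definite_def transpose_def vec_eq_iff)
  moreover have "0 \<le> y \<bullet> (Z *v y)" for y
    using le[of y] by (simp add: Zv inner_diff_right)
  moreover have "x \<bullet> (Z *v x) = 0"
    using posY[OF x0] by (simp add: Zv inner_diff_right f_def)
  ultimately have "Z *v x = 0" by (rule psd_null_vector)
  then show thesis
    using that[of x "f x"] x0 le by (simp add: Zv)
qed

section \<open>Operator norm and quadratic forms\<close>

lemma norm_matrix_vector_le: "norm (A *v x) \<le> op_norm A * norm x"
  unfolding op_norm_def by (rule onorm) (rule matrix_vector_mul_bounded_linear)

lemma op_norm_nonneg: "0 \<le> op_norm A"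
  unfolding op_norm_def by (rule onorm_pos_le) (rule matrix_vector_mul_bounded_linear)

lemma abs_quadratic_form_le: "\<bar>x \<bullet> (A *v x)\<bar> \<le> op_norm A * (x \<bullet> x)"
proof -
  have "\<bar>x \<bullet> (A *v x)\<bar> \<le> norm x * norm (A *v x)"
    by (rule Cauchy_Schwarz_ineq2)
  also have "\<dots> \<le> norm x * (op_norm A * norm x)"
    by (intro mult_left_mono norm_matrix_vector_le) simp
  finally show ?thesis
    by (simp add: mult.left_commute flip: power2_norm_eq_inner power2_eq_square)
qed

text \<open>Polarisation: symmetry makes the two cross terms equal, so
  \<open>x \<bullet> (A *v y)\<close> is a difference of values of the form at \<open>x + y\<close>
  and \<open>x - y\<close>.\<close>

lemma op_norm_symmetric_le:
  fixes A :: "real^'m^'m"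
  assumes sym: "symmetric_matrix A" and bound: "\<And>y. \<bar>y \<bullet> (A *v y)\<bar> \<le> b * (y \<bullet> y)"
  shows "op_norm A \<le> b"
proof -
  have "norm (A *v y) \<le> b * norm y" for y
  proof (cases "y = 0 \<or> A *v y = 0")
    case True
    \<comment> \<open>The sign of \<open>b\<close> is read off from the bound at \<open>y\<close>
      itself, unless \<open>y = 0\<close>.\<close>
    have "0 \<le> b * (y \<bullet> y)" using bound[of y] by linarith
    then have "0 \<le> b \<or> y = 0"
      using inner_gt_zero_iff[of y] by (auto simp: zero_le_mult_iff simp del: inner_gt_zero_iff)
    with True show ?thesis by auto
  next
    case False
    \<comment> \<open>\<open>x\<close> points along \<open>A *v y\<close>, making Cauchy-Schwarz an
      equality, and has the length of \<open>y\<close>, so the parallelogram law gives exactly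
      \<open>4 * (y \<bullet> y)\<close> below.\<close>
    define x where "x = (norm y / norm (A *v y)) *\<^sub>R (A *v y)"
    have nx: "x \<bullet> x = y \<bullet> y"
      using False by (simp add: x_def flip: power2_norm_eq_inner)
    have polar: "4 * (x \<bullet> (A *v y)) = (x + y) \<bullet> (A *v (x + y)) - (x - y) \<bullet> (A *v (x - y))"
      using inner_symmetric_matrix[OF sym, of x y]
      by (simp add: inner_diff_left inner_diff_right inner_add_left inner_add_right
          matrix_vector_mult_diff_distrib matrix_vector_right_distrib inner_commute)
    also have "\<dots> \<le> b * ((x + y) \<bullet> (x + y)) + b * ((x - y) \<bullet> (x - y))"
      using bound[of "x + y"] bound[of "x - y"] by linarith
    also have "\<dots> = 4 * (b * (y \<bullet> y))"
      by (simp add: inner_diff_left inner_diff_right inner_add_left inner_add_right nx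
          inner_commute algebra_simps)
    finally have "x \<bullet> (A *v y) \<le> b * (y \<bullet> y)" by simp
    moreover have "x \<bullet> (A *v y) = norm y * norm (A *v y)"
      using False by (simp add: x_def power2_eq_square flip: power2_norm_eq_inner)
    ultimately have "norm y * norm (A *v y) \<le> norm y * (b * norm y)"
      by (simp add: mult.left_commute flip: power2_norm_eq_inner power2_eq_square)
    with False show ?thesis by (simp add: mult_le_cancel_left)
  qed
  then show ?thesis unfolding op_norm_def by (rule onorm_le)
qed

section \<open>Positive definite matrices and their inverses\<close>

lemma positive_definite_mat_1: "positive_definite (mat 1 :: real^'m^'m)"
  by (simp add: positive_definite_def symmetric_matrix_def)

lemma positive_definite_invertible:
  fixes M :: "real^'m^'m"
  assumes "positive_definite M"
  shows "invertible M"
proof -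
  have "x = 0" if "M *v x = 0" for x
    using assms that unfolding positive_definite_def by (metis inner_zero_right less_irrefl)
  then show ?thesis
    using matrix_left_invertible_ker invertible_left_inverse by metis
qed

lemma matrix_inv_inverse:
  fixes M :: "real^'m^'m"
  assumes "invertible M"
  shows matrix_inv_right: "M ** matrix_inv M = mat 1"
    and matrix_inv_left: "matrix_inv M ** M = mat 1"
  using someI_ex[OF assms[unfolded invertible_def]] by (auto simp: matrix_inv_def)

lemma matrix_inv_cancel_vector:
  fixes M :: "real^'m^'m"
  assumes "invertible M"
  shows "matrix_inv M *v (M *v x) = x"
  using matrix_inv_left[OF assms] by (simp add: matrix_vector_mul_assoc)

text \<open>The optimal constant is the largest \<open>l\<close> with \<open>x = l M x\<close> for
  some \<open>x \<noteq> 0\<close>. It is an eigenvalue of the inverse of \<open>M\<close>, hence at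
  most its operator norm.\<close>

lemma inner_self_le_positive_definite:
  fixes M :: "real^'m^'m"
  assumes "positive_definite M"
  shows "y \<bullet> y \<le> op_norm (matrix_inv M) * (y \<bullet> (M *v y))"
proof -
  have "symmetric_matrix (mat 1 :: real^'m^'m)" by (simp add: symmetric_matrix_def)
  then obtain x l where x: "x \<noteq> 0" "mat 1 *v x = l *\<^sub>R (M *v x)"
    and le: "\<And>y. y \<bullet> (mat 1 *v y) \<le> l * (y \<bullet> (M *v y))"
    using generalized_eigenvector assms by blast
  have "matrix_inv M *v x = matrix_inv M *v (l *\<^sub>R (M *v x))"
    using x by simp
  also have "\<dots> = l *\<^sub>R x"
    by (simp add: matrix_vector_mult_scaleR matrix_inv_cancel_vector positive_definite_invertible assms)
  finally have "\<bar>l\<bar> * norm x \<le> op_norm (matrix_inv M) * norm x"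
    using norm_matrix_vector_le[of "matrix_inv M" x] by simp
  then have "l \<le> op_norm (matrix_inv M)"
    using x by (simp add: mult_le_cancel_right)
  moreover have "0 \<le> y \<bullet> (M *v y)"
    using assms by (cases "y = 0") (auto simp: positive_definite_def intro: less_imp_le)
  ultimately show ?thesis
    using le[of y] by (smt (verit) matrix_vector_mul_lid mult_right_mono)
qed

section \<open>Comparison of geometric means\<close>

lemma inner_congruence:
  fixes A B :: "real^'m^'m"
  shows "x \<bullet> ((transpose A ** B ** A) *v x) = (A *v x) \<bullet> (B *v (A *v x))"
  using dot_lmul_matrix[of x "transpose A" "B *v (A *v x)"]
  by (simp add: matrix_vector_mul_assoc matrix_mul_assoc vector_transpose_matrix)

text \<open>\<open>W\<close> stays arbitrary and neither \<open>P\<close> nor \<open>P'\<close> has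
  to be symplectic. The lemma thus compares \<open>P\<close> with \<open>P'\<close> and also either
  of them with the identity.\<close>

lemma geometric_mean_comparison:
  fixes P P' M M' W :: "real^'m^'m"
  assumes P: "positive_definite P" and P': "positive_definite P'"
    and M: "positive_definite M"
    and eq: "P ** (W ** M ** transpose W) ** P = M"
    and eq': "P' ** (W ** M' ** transpose W) ** P' = M'"
    and a: "\<And>x. x \<bullet> (M' *v x) \<le> a * (x \<bullet> (M *v x))"
    and b: "\<And>x. x \<bullet> (M *v x) \<le> b * (x \<bullet> (M' *v x))"
    and "0 \<le> b"
  shows "y \<bullet> (P' *v y) \<le> sqrt (a * b) * (y \<bullet> (P *v y))"
proof -
  \<comment> \<open>The equation says that the congruence by \<open>transpose W ** P\<close> maps
    \<open>M\<close> to itself, so the form of \<open>M\<close> takes equal values at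
    \<open>x\<close> and at its image.\<close>
  have form: "x \<bullet> (M *v x) = (transpose W *v (P *v x)) \<bullet> (M *v (transpose W *v (P *v x)))"
    if "positive_definite P" "P ** (W ** M ** transpose W) ** P = M" for P M :: "real^'m^'m" and x
  proof -
    have "transpose P = P" using that by (simp add: positive_definite_def symmetric_matrix_def)
    then have "M = transpose (transpose W ** P) ** M ** (transpose W ** P)"
      using that(2) by (simp add: matrix_transpose_mul matrix_mul_assoc)
    then have "x \<bullet> (M *v x) = x \<bullet> ((transpose (transpose W ** P) ** M ** (transpose W ** P)) *v x)"
      by (rule arg_cong)
    then show ?thesis
      by (simp only: inner_congruence matrix_vector_mul_assoc)
  qed
  obtain x l where x: "x \<noteq> 0" "P' *v x = l *\<^sub>R (P *v x)"
    and le: "\<And>y. y \<bullet> (P' *v y) \<le> l * (y \<bullet> (P *v y))"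
    using generalized_eigenvector[of P' P] P P' by (auto simp: positive_definite_def)
  have pos: "0 < x \<bullet> (M *v x)"
    using M x by (simp add: positive_definite_def)
  define u where "u = transpose W *v (P' *v x)"
  have u: "u = l *\<^sub>R (transpose W *v (P *v x))"
    by (simp add: u_def x matrix_vector_mult_scaleR)
  \<comment> \<open>At the eigenvector the images of \<open>x\<close> for \<open>P\<close> and
    \<open>P'\<close> differ only by the factor \<open>l\<close>. Passing from \<open>M\<close> to
    \<open>M'\<close> at \<open>u\<close> costs \<open>b\<close>, and returning at \<open>x\<close>
    costs \<open>a\<close>.\<close>
  have "l\<^sup>2 * (x \<bullet> (M *v x)) = u \<bullet> (M *v u)"
    unfolding form[OF P eq, of x] u by (simp add: matrix_vector_mult_scaleR power2_eq_square)
  also have "\<dots> \<le> b * (u \<bullet> (M' *v u))" by (rule b)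
  also have "\<dots> = b * (x \<bullet> (M' *v x))"
    unfolding form[OF P' eq', of x] u_def ..
  also have "\<dots> \<le> b * (a * (x \<bullet> (M *v x)))"
    by (intro mult_left_mono a \<open>0 \<le> b\<close>)
  finally have "l\<^sup>2 \<le> a * b"
    using pos by (simp add: mult.commute mult.left_commute)
  then have "l \<le> sqrt (a * b)"
    by (rule real_le_rsqrt)
  moreover have "0 \<le> y \<bullet> (P *v y)"
    using P by (cases "y = 0") (auto simp: positive_definite_def intro: less_imp_le)
  ultimately show ?thesis
    using le[of y] by (meson mult_right_mono order_trans)
qed

section \<open>Williamson decompositions\<close>

lemma block_matrix_mult:
  "block_matrix A B C D ** block_matrix A' B' C' D' =
    block_matrix (A ** A' + B ** C') (A ** B' + B ** D') (C ** A' + D ** C') (C ** B' + D ** D')"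
  by (auto simp: block_matrix_def matrix_matrix_mult_def vec_eq_iff sum.Plus
      simp flip: UNIV_Plus_UNIV split: sum.splits)

lemma transpose_block_matrix:
  "transpose (block_matrix A B C D) =
    block_matrix (transpose A) (transpose C) (transpose B) (transpose D)"
  by (auto simp: block_matrix_def transpose_def vec_eq_iff split: sum.splits)

lemma mat_1_block_matrix: "mat 1 = block_matrix (mat 1) 0 0 (mat 1)"
  by (auto simp: block_matrix_def mat_def vec_eq_iff split: sum.splits)

lemma uminus_block_matrix:
  "- block_matrix A B C D = block_matrix (- A) (- B) (- C) (- D)"
  by (auto simp: block_matrix_def vec_eq_iff split: sum.splits)

lemma matrix_mul_minus_left: "(- A) ** B = - (A ** (B :: real^'m^'m))"
  by (simp add: matrix_matrix_mult_def vec_eq_iff sum_negf)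

lemma matrix_mul_minus_right: "A ** (- B) = - (A ** (B :: real^'m^'m))"
  by (simp add: matrix_matrix_mult_def vec_eq_iff sum_negf)

lemma transpose_minus: "transpose (- A) = - transpose (A :: real^'m^'m)"
  by (simp add: transpose_def vec_eq_iff)

section \<open>The symplectic form and symplectic matrices\<close>

lemma transpose_symplectic_form: "transpose symplectic_form = - symplectic_form"
  by (simp add: symplectic_form_def transpose_block_matrix uminus_block_matrix transpose_minus)
    (simp add: transpose_def zero_vec_def)

lemma symplectic_form_square: "symplectic_form ** symplectic_form = - mat 1"
  by (simp add: symplectic_form_def mat_1_block_matrix block_matrix_mult uminus_block_matrix
      matrix_mul_minus_left matrix_mul_minus_right)

lemma symplectic_form_block_diagonal:
  "symplectic_form ** block_matrix D 0 0 D ** transpose symplectic_form = block_matrix D 0 0 D"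
  unfolding transpose_symplectic_form
  by (simp add: symplectic_form_def block_matrix_mult uminus_block_matrix
      matrix_mul_minus_left matrix_mul_minus_right)

lemma symplectic_invertible:
  assumes "symplectic S"
  shows "invertible S"
proof -
  have "- symplectic_form ** transpose S ** symplectic_form ** S = mat 1"
    using assms unfolding symplectic_def
    by (metis matrix_mul_assoc matrix_mul_minus_left minus_minus symplectic_form_square)
  then show ?thesis
    unfolding invertible_left_inverse by blast
qed

text \<open>Inverting the definition directly would put the transpose on the left of J. The other
  order comes from \<open>J S = T^T J\<close>, which gives
  \<open>(T J T^T) J = T J J S = -1\<close>.\<close>

lemma symplectic_inverse:
  fixes S :: "real^('n::finite + 'n)^('n + 'n)"
  assumes "symplectic S"
  defines "T \<equiv> matrix_inv S"
  shows "T ** symplectic_form ** transpose T = symplectic_form"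
proof -
  let ?J = "symplectic_form :: real^('n + 'n)^('n + 'n)"
  have TS: "T ** S = mat 1" and ST: "S ** T = mat 1"
    using symplectic_invertible[OF assms(1)] by (simp_all add: T_def matrix_inv_left matrix_inv_right)
  have TtSt: "transpose T ** transpose S = mat 1"
    using ST by (metis matrix_transpose_mul transpose_mat)
  have JS: "?J ** S = transpose T ** ?J"
  proof -
    have "?J ** S = transpose T ** (transpose S ** ?J ** S)"
      by (simp add: matrix_mul_assoc TtSt)
    then show ?thesis using assms(1) by (simp add: symplectic_def)
  qed
  have "(T ** ?J ** transpose T) ** ?J = T ** ?J ** (?J ** S)"
    by (simp add: JS matrix_mul_assoc)
  also have "\<dots> = T ** (?J ** ?J) ** S"
    by (simp add: matrix_mul_assoc)
  also have "\<dots> = - mat 1"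
    by (simp add: symplectic_form_square matrix_mul_minus_left matrix_mul_minus_right TS)
  finally have "(T ** ?J ** transpose T) ** (?J ** ?J) = - ?J"
    by (metis matrix_mul_assoc matrix_mul_lid matrix_mul_minus_left)
  then show ?thesis
    by (simp add: symplectic_form_square matrix_mul_minus_right)
qed

text \<open>With \<open>T = S^-1\<close> and \<open>B = diag(D, D)\<close>, the product regroups
  around \<open>T J T^T = J\<close> and its transpose. What remains is \<open>J B J^T = B\<close>,
  since J commutes with \<open>B\<close>.\<close>

lemma williamson_geometric_mean:
  assumes "williamson_decomposition M S D"
  defines "P \<equiv> transpose (matrix_inv S) ** matrix_inv S"
  shows "positive_definite P"
    and "P ** (symplectic_form ** M ** transpose symplectic_form) ** P = M"
proof -
  define T where "T = matrix_inv S"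
  let ?J = "symplectic_form :: real^('a + 'a)^('a + 'a)"
  define B where "B = block_matrix D 0 0 D"
  have symp: "symplectic S" and M: "M = transpose T ** B ** T"
    using assms(1) by (simp_all add: williamson_decomposition_def T_def B_def)
  have P: "P = transpose T ** T" by (simp add: P_def T_def)
  have ST: "S ** T = mat 1"
    using symplectic_invertible[OF symp] by (simp add: T_def matrix_inv_right)
  have "0 < x \<bullet> (P *v x)" if "x \<noteq> 0" for x
  proof -
    have "T *v x \<noteq> 0"
      using that ST by (metis matrix_vector_mul_assoc matrix_vector_mul_lid matrix_vector_mult_0_right)
    then show ?thesis
      using inner_congruence[of x T "mat 1"] by (simp add: P)
  qed
  then show "positive_definite P"
    by (simp add: positive_definite_def symmetric_matrix_def P matrix_transpose_mul)
  have TJT: "T ** ?J ** transpose T = ?J"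
    using symplectic_inverse[OF symp] by (simp add: T_def)
  then have TJtT: "T ** transpose ?J ** transpose T = transpose ?J"
    by (metis matrix_mul_assoc matrix_transpose_mul transpose_transpose)
  have "P ** (?J ** M ** transpose ?J) ** P =
      transpose T ** (T ** ?J ** transpose T) ** B ** (T ** transpose ?J ** transpose T) ** T"
    by (simp add: P M matrix_mul_assoc)
  also have "\<dots> = transpose T ** (?J ** B ** transpose ?J) ** T"
    unfolding TJT TJtT by (simp add: matrix_mul_assoc)
  also have "\<dots> = M"
    by (simp add: M B_def symplectic_form_block_diagonal)
  finally show "P ** (?J ** M ** transpose ?J) ** P = M" .
qed

section \<open>The perturbation estimate\<close>

theorem theorem5p1:
  fixes M E S S\<^sub>\<epsilon> :: "real^('n::{finite,linorder} + 'n)^('n + 'n)"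
    and D D\<^sub>\<epsilon> :: "real^('n::{finite,linorder})^('n::{finite,linorder})"
    and \<epsilon> :: real
  assumes "positive_definite M"
    and "williamson_decomposition M S D"
    and "symmetric_matrix E"
    and "op_norm E = 1"
    and "positive_definite (M + \<epsilon> *\<^sub>R E)"
    and "williamson_decomposition (M + \<epsilon> *\<^sub>R E) S\<^sub>\<epsilon> D\<^sub>\<epsilon>"
    and "0 < \<epsilon>"
    and "\<epsilon> < Min {op_norm M / (6 * cond_num M) powr (4/3), 1 / (2 * op_norm M), op_norm M}"
  shows "op_norm (transpose (matrix_inv S) ** matrix_inv S
                  - transpose (matrix_inv S\<^sub>\<epsilon>) ** matrix_inv S\<^sub>\<epsilon>)
         \<le> 9 * pi * real CARD('n) ^ 3 * (cond_num M)\<^sup>2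
             * op_norm (matrix_inv M) powr (1/4) * \<epsilon> powr (1/4)"
proof -
  define P where "P = transpose (matrix_inv S) ** matrix_inv S"
  define P' where "P' = transpose (matrix_inv S\<^sub>\<epsilon>) ** matrix_inv S\<^sub>\<epsilon>"
  define M' where "M' = M + \<epsilon> *\<^sub>R E"
  define m where "m = op_norm (matrix_inv M)"
  define \<kappa> where "\<kappa> = cond_num M"
  define \<delta> where "\<delta> = \<epsilon> * m"
  note P = williamson_geometric_mean[OF assms(2), folded P_def]
  note P' = williamson_geometric_mean[OF assms(6), folded P'_def M'_def]
  have \<kappa>: "\<kappa> = op_norm M * m" by (simp add: \<kappa>_def cond_num_def m_def)
  have m: "y \<bullet> y \<le> m * (y \<bullet> (M *v y))" for y
    unfolding m_def by (rule inner_self_le_positive_definite[OF assms(1)])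
  have M_le: "y \<bullet> (M *v y) \<le> op_norm M * (y \<bullet> y)" for y
    using abs_quadratic_form_le[of y M] by linarith
  have "0 \<le> m" by (simp add: m_def op_norm_nonneg)
  have "1 \<le> \<kappa>"
  proof -
    obtain e :: "real^('n + 'n)" where e: "norm e = 1"
      using vector_choose_size[of 1] by auto
    then have ee: "e \<bullet> e = 1" by (simp flip: power2_norm_eq_inner)
    have "e \<bullet> e \<le> m * (op_norm M * (e \<bullet> e))"
      using m[of e] mult_left_mono[OF M_le[of e] \<open>0 \<le> m\<close>] by linarith
    with ee show ?thesis by (simp add: \<kappa> mult.commute)
  qed
  have "m > 0" using \<open>1 \<le> \<kappa>\<close> \<open>0 \<le> m\<close> \<kappa> by (cases "m = 0") auto
  have "\<delta> > 0" using \<open>m > 0\<close> assms(7) by (simp add: \<delta>_def)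
  \<comment> \<open>Only the first term of the minimum enters: since
    \<open>6 * \<kappa> \<ge> 1\<close>, the exponent 4/3 may be lowered to 1, and
    \<open>op_norm M * m = \<kappa>\<close>.\<close>
  have "\<delta> \<le> 1/6"
  proof -
    have "(6 * \<kappa>) powr 1 \<le> (6 * \<kappa>) powr (4/3)"
      using \<open>1 \<le> \<kappa>\<close> by (intro powr_mono) auto
    moreover have "\<epsilon> \<le> op_norm M / (6 * \<kappa>) powr (4/3)"
      using assms(8) by (simp add: \<kappa>_def)
    ultimately have "\<epsilon> \<le> op_norm M / (6 * \<kappa>)"
      using \<open>1 \<le> \<kappa>\<close> op_norm_nonneg[of M]
      by (smt (verit) frac_le powr_one)
    then have "\<delta> \<le> op_norm M / (6 * \<kappa>) * m"
      unfolding \<delta>_def using \<open>0 \<le> m\<close> by (rule mult_right_mono)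
    also have "\<dots> = 1/6" using \<kappa> \<open>1 \<le> \<kappa>\<close> by auto
    finally show ?thesis .
  qed
  \<comment> \<open>Since \<open>E\<close> has norm 1, its form is at most
    \<open>y \<bullet> y\<close>, and \<open>m\<close> converts this into a bound relative to the
    form of \<open>M\<close>.\<close>
  have perturb: "\<bar>y \<bullet> (M' *v y) - y \<bullet> (M *v y)\<bar> \<le> \<delta> * (y \<bullet> (M *v y))" for y
  proof -
    have "y \<bullet> (M' *v y) - y \<bullet> (M *v y) = \<epsilon> * (y \<bullet> (E *v y))"
      by (simp add: M'_def matrix_vector_mult_add_rdistrib inner_add_right
          flip: scaleR_matrix_vector_assoc)
    then have "\<bar>y \<bullet> (M' *v y) - y \<bullet> (M *v y)\<bar> = \<epsilon> * \<bar>y \<bullet> (E *v y)\<bar>"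
      using assms(7) by (simp add: abs_mult)
    also have "\<dots> \<le> \<epsilon> * (y \<bullet> y)"
      using abs_quadratic_form_le[of y E] assms(4,7) by (intro mult_left_mono) auto
    also have "\<dots> \<le> \<epsilon> * (m * (y \<bullet> (M *v y)))"
      using m assms(7) by (intro mult_left_mono) auto
    finally show ?thesis by (simp add: \<delta>_def)
  qed
  have upper: "y \<bullet> (M' *v y) \<le> (1 + \<delta>) * (y \<bullet> (M *v y))" for y
    using perturb[of y] by (simp add: algebra_simps)
  have lower: "y \<bullet> (M *v y) \<le> 1 / (1 - \<delta>) * (y \<bullet> (M' *v y))" for y
    using perturb[of y] \<open>\<delta> \<le> 1/6\<close> by (simp add: field_simps)
  \<comment> \<open>This is the factor \<open>sqrt (a * b)\<close> of
    \<open>geometric_mean_comparison\<close> for the constants of \<open>upper\<close> and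
    \<open>lower\<close>.\<close>
  define c where "c = sqrt ((1 + \<delta>) * (1 / (1 - \<delta>)))"
  have "c \<ge> 1"
    using \<open>\<delta> > 0\<close> \<open>\<delta> \<le> 1/6\<close> by (simp add: c_def)
  have "c \<le> 1 + 2 * \<delta>"
  proof -
    have "1 + \<delta> \<le> (1 + 2 * \<delta>)\<^sup>2 * (1 - \<delta>)"
    proof -
      have "(1 + 2 * \<delta>)\<^sup>2 * (1 - \<delta>) - (1 + \<delta>) = 2 * \<delta> * (1 - 2 * \<delta>\<^sup>2)"
        by (simp add: power2_eq_square algebra_simps)
      moreover have "\<delta>\<^sup>2 \<le> (1/6)\<^sup>2" using \<open>\<delta> > 0\<close> \<open>\<delta> \<le> 1/6\<close> by (intro power_mono) auto
      then have "0 \<le> 2 * \<delta> * (1 - 2 * \<delta>\<^sup>2)"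
        using \<open>\<delta> > 0\<close> by (intro mult_nonneg_nonneg) (auto simp: power2_eq_square)
      ultimately show ?thesis by linarith
    qed
    then show ?thesis
      unfolding c_def using \<open>\<delta> > 0\<close> \<open>\<delta> \<le> 1/6\<close>
      by (intro real_le_lsqrt) (auto simp: field_simps)
  qed
  have "y \<bullet> (P' *v y) \<le> c * (y \<bullet> (P *v y))" for y
    unfolding c_def using \<open>\<delta> \<le> 1/6\<close>
    by (intro geometric_mean_comparison[OF P(1) P'(1) assms(1) P(2) P'(2) upper lower]) auto
  \<comment> \<open>Exchanging the two matrices exchanges \<open>a\<close> and \<open>b\<close>, so
    the same \<open>c\<close> serves.\<close>
  moreover have "y \<bullet> (P *v y) \<le> c * (y \<bullet> (P' *v y))" for y
    unfolding c_def mult.commute[of "1 + \<delta>"] using \<open>\<delta> > 0\<close> assms(5)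
    by (intro geometric_mean_comparison[OF P'(1) P(1) _ P'(2) P(2) lower upper]) (auto simp: M'_def)
  ultimately have close: "\<bar>y \<bullet> ((P - P') *v y)\<bar> \<le> (c - 1) * (y \<bullet> (P *v y))" for y
  proof -
    define p p' where "p = y \<bullet> (P *v y)" and "p' = y \<bullet> (P' *v y)"
    assume *: "\<And>y. y \<bullet> (P' *v y) \<le> c * (y \<bullet> (P *v y))"
      "\<And>y. y \<bullet> (P *v y) \<le> c * (y \<bullet> (P' *v y))"
    have p: "p' \<le> c * p" "p \<le> c * p'" using * by (simp_all add: p_def p'_def)
    \<comment> \<open>The hypotheses give \<open>(c - 1) * p'\<close>; when \<open>p' < p\<close>
      this is at most the wanted bound, otherwise the left side is nonpositive.\<close>
    have "p - p' \<le> (c - 1) * p"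
    proof (cases "p \<le> p'")
      case True
      have "0 \<le> p"
        using P(1) by (cases "y = 0") (auto simp: p_def positive_definite_def intro: less_imp_le)
      with True \<open>c \<ge> 1\<close> show ?thesis
        by (smt (verit) mult_nonneg_nonneg)
    next
      case False
      then have "(c - 1) * p' \<le> (c - 1) * p"
        using \<open>c \<ge> 1\<close> by (intro mult_left_mono) auto
      with p show ?thesis by (simp add: algebra_simps)
    qed
    moreover have "p' - p \<le> (c - 1) * p" using p by (simp add: algebra_simps)
    moreover have "y \<bullet> ((P - P') *v y) = p - p'"
      by (simp add: p_def p'_def matrix_vector_mult_diff_rdistrib inner_diff_right)
    ultimately show ?thesis by (simp add: p_def)
  qed
  \<comment> \<open>The identity solves the geometric mean equation for \<open>M = mat 1\<close>,
    because \<open>J J^T = 1\<close>. Here \<open>a = op_norm M\<close> and \<open>b = m\<close>,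
    with product \<open>\<kappa>\<close>.\<close>
  have "y \<bullet> (P *v y) \<le> sqrt \<kappa> * (y \<bullet> y)" for y
  proof -
    have J: "symplectic_form ** mat 1 ** transpose symplectic_form
        = (mat 1 :: real^('n + 'n)^('n + 'n))"
      by (simp add: transpose_symplectic_form matrix_mul_minus_right symplectic_form_square)
    have "y \<bullet> (P *v y) \<le> sqrt (op_norm M * m) * (y \<bullet> (mat 1 *v y))"
      by (rule geometric_mean_comparison[OF positive_definite_mat_1 P(1) positive_definite_mat_1 _ P(2)])
        (use M_le m \<open>0 \<le> m\<close> J in auto)
    then show ?thesis by (simp add: \<kappa>)
  qed
  then have "(c - 1) * (y \<bullet> (P *v y)) \<le> (c - 1) * (sqrt \<kappa> * (y \<bullet> y))" for y
    using \<open>c \<ge> 1\<close> by (intro mult_left_mono) auto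
  moreover have "(c - 1) * (sqrt \<kappa> * (y \<bullet> y)) \<le> (2 * \<delta>) * (sqrt \<kappa> * (y \<bullet> y))" for y
    using \<open>c \<le> 1 + 2 * \<delta>\<close> \<open>1 \<le> \<kappa>\<close> by (intro mult_right_mono) auto
  ultimately have "\<bar>y \<bullet> ((P - P') *v y)\<bar> \<le> (2 * \<delta> * sqrt \<kappa>) * (y \<bullet> y)" for y
    unfolding mult.assoc[of "2 * \<delta>"] using close by (meson order_trans)
  moreover have "symmetric_matrix (P - P')"
    using P(1) P'(1) by (simp add: positive_definite_def symmetric_matrix_def transpose_def vec_eq_iff)
  ultimately have "op_norm (P - P') \<le> 2 * \<delta> * sqrt \<kappa>"
    by (intro op_norm_symmetric_le)
  \<comment> \<open>From here the estimate is only weakened to the stated shape, using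
    \<open>\<delta> \<le> 1\<close> and \<open>\<kappa> \<ge> 1\<close>.\<close>
  also have "\<dots> \<le> 2 * (\<delta> powr (1/4)) * \<kappa>\<^sup>2"
  proof (intro mult_mono)
    have "\<delta> powr 1 \<le> \<delta> powr (1/4)"
      using \<open>\<delta> > 0\<close> \<open>\<delta> \<le> 1/6\<close> by (intro powr_mono') auto
    then show "\<delta> \<le> \<delta> powr (1/4)" using \<open>\<delta> > 0\<close> by simp
    have "\<kappa> \<le> (\<kappa>\<^sup>2)\<^sup>2" using power_increasing[of 1 4 \<kappa>] \<open>1 \<le> \<kappa>\<close> by simp
    then show "sqrt \<kappa> \<le> \<kappa>\<^sup>2" by (intro real_le_lsqrt) auto
  qed (use \<open>\<delta> > 0\<close> \<open>1 \<le> \<kappa>\<close> in auto)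
  also have "\<dots> \<le> (9 * pi * real CARD('n) ^ 3) * \<delta> powr (1/4) * \<kappa>\<^sup>2"
  proof (intro mult_right_mono)
    have "1 \<le> real CARD('n) ^ 3" by (simp add: Suc_leI)
    moreover have "2 \<le> 9 * pi" using pi_gt3 by simp
    ultimately show "2 \<le> 9 * pi * real CARD('n) ^ 3"
      using mult_mono[of 2 "9 * pi" 1 "real CARD('n) ^ 3"] by simp
  qed auto
  also have "\<dots> = 9 * pi * real CARD('n) ^ 3 * \<kappa>\<^sup>2 * m powr (1/4) * \<epsilon> powr (1/4)"
    using \<open>m > 0\<close> assms(7) by (simp add: \<delta>_def powr_mult)
  finally show ?thesis
    by (simp add: P_def P'_def \<kappa>_def m_def)
qed

end
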